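(* Suppose the volume and surface quadrature rules on the reference triangle $\hat D$ form an SBP quadrature rule (as defined in the context). For $i=x,y$ define $$ \mathbf Q^i_{\rm SBP}=\begin{bmatrix}\mathbf I\\ \mathbf I_f\end{bmatrix}^T\mathbf Q_h^i\begin{bmatrix}\mathbf I\\ \mathbf I_f\end{bmatrix}, $$ where $\mathbf Q_h^i$ is the hybridized SBP operator, $\mathbf I$ is the $N_q\times N_q$ identity matrix and $\mathbf I_f$ is the selection matrix extracting surface nodes from the volume quadrature nodes. Then $\mathbf Q^i_{\rm SBP}$ is a multi-dimensional SBP operator, i.e. for $i=x,y$: (1) with $\mathbf M_{\rm SBP}=\mathrm{diag}(w_1,\dots,w_{N_q})$ and $\mathbf D^i_{\rm SBP}=\mathbf M_{\rm SBP}^{-1}\mathbf Q^i_{\rm SBP}$, for every polynomial $p\in P^N(\hat D)$ with nodal values $\mathbf p=(p(\hat{\mathbf x}_1),\dots,p(\hat{\mathbf x}_{N_q}))^T$ one has $(\mathbf D^i_{\rm SBP}\mathbf p)_j=\frac{\partial p}{\partial \hat x_i}(\hat{\mathbf x}_j)$ for all $1\le j\le N_q$; (2) $\mathbf Q^i_{\rm SBP}+(\mathbf Q^i_{\rm SBP})^T=\mathbf I_f^T\mathbf B^i\mathbf I_f$, the $N_q\times N_q$ diagonal surface matrix whose entries are the surface quadrature weights scaled by the $i$th component of the outward normal, placed at the positions of the boundary nodes.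
   Context: $\hat D$ is the triangle with vertices $(-1,-1),(1,-1),(-1,1)$; $P^N(\hat D)$ is the space of polynomials of total degree at most $N$ on $\hat D$, with basis $\{\phi_j\}_{j=1}^{N_p}$. Indices $i=x,y$ (equivalently $i=1,2$) refer to coordinate directions. SBP quadrature rule: a volume rule with nodes $\{\hat{\mathbf x}_i\}_{i=1}^{N_q}$ in $\hat D$ and positive weights $\{w_i\}_{i=1}^{N_q}$, exact for polynomials of degree up to $2N-1$ on $\hat D$, whose nodes include boundary points that form the nodes $\{\hat{\mathbf x}_i^f\}_{i=1}^{N_q^f}$ of a separate surface quadrature rule with weights $\{w_i^f\}$; the surface nodes are identically distributed on each face and the surface rule is exact for polynomials of degree $2N$ on each face. Matrices: $\mathbf W=\mathrm{diag}(w_i)$, $\mathbf W_f=\mathrm{diag}(w_i^f)$, $(\mathbf V_q)_{ij}=\phi_j(\hat{\mathbf x}_i)$, $(\mathbf V_f)_{ij}=\phi_j(\hat{\mathbf x}_i^f)$. $\mathbf D^i$ is the $N_p\times N_p$ matrix mapping basis coefficients of a polynomial in $P^N(\hat D)$ to basis coefficients of its derivative with respect to $\hat x_i$. $\mathbf M=\mathbf V_q^T\mathbf W\mathbf V_q$ (assumed invertible), $\mathbf P_q=\mathbf M^{-1}\mathbf V_q^T\mathbf W$, $\mathbf E=\mathbf V_f\mathbf P_q$, $\mathbf Q^i=\mathbf P_q^T\mathbf M\mathbf D^i\mathbf P_q$, and $\mathbf B^i=\mathbf W_f\,\mathrm{diag}(\hat{\mathbf n}_i)$, where $\hat{\mathbf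 n}_i$ is the vector, over surface quadrature nodes, of the $i$th component of the outward normal on $\partial\hat D$ scaled by the face Jacobian (so that $\mathbf V_f^T\mathbf B^i\mathbf V_f$ has entries $\int_{\partial\hat D}\phi_k\phi_l\,n_i$, with $n_i$ the $i$th component of the outward unit normal). The hybridized SBP operator is the $(N_q+N_q^f)\times(N_q+N_q^f)$ matrix $$\mathbf Q_h^i=\frac12\begin{bmatrix}\mathbf Q^i-(\mathbf Q^i)^T&\mathbf E^T\mathbf B^i\\-\mathbf B^i\mathbf E&\mathbf B^i\end{bmatrix}.$$ Selection matrix: $\mathbf I_f$ is the $N_q^f\times N_q$ matrix with $(\mathbf I_f)_{ji}=1$ if the $i$th volume quadrature node coincides with the $j$th surface quadrature node, and $0$ otherwise; thus $\mathbf I_f$ maps values at all quadrature nodes to values at surface nodes. *)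

theory Defs
  imports "HOL-Analysis.Analysis"
begin

section \<open>Reference triangle and polynomials\<close>

text \<open>
  The plane is \<^typ>\<open>real \<times> real\<close>. A coordinate direction is an element of \<^term>\<open>Basis\<close>, which is
  (1,0) for x and (0,1) for y; the component of a vector n in direction i is n \<open>\<bullet>\<close> i.
\<close>

type_synonym point = "real \<times> real"

definition ref_triangle :: "point set" where
  "ref_triangle = convex hull {(-1, -1), (1, -1), (-1, 1)}"

text \<open>
  Polynomials of total degree at most N. They are kept as functions on the whole plane, which their
  values on the triangle determine, so that derivatives at boundary points make sense.
\<close>

definition poly_space :: "nat \<Rightarrow> (point \<Rightarrow> real) set" where
  "poly_space N =
    {p. \<exists>c :: nat \<Rightarrow> nat \<Rightarrow> real.
          \<forall>x y. p (x, y) = (\<Sum>(a, b) | a + b \<le> N. c a b * x ^ a * y ^ b)}"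

definition partial_deriv :: "point \<Rightarrow> (point \<Rightarrow> real) \<Rightarrow> point \<Rightarrow> real" where
  "partial_deriv i p x = deriv (\<lambda>t. p (x + t *\<^sub>R i)) 0"

definition expand :: "('p::finite \<Rightarrow> point \<Rightarrow> real) \<Rightarrow> real^'p \<Rightarrow> point \<Rightarrow> real" where
  "expand \<phi> c x = (\<Sum>j\<in>UNIV. c $ j * \<phi> j x)"

definition poly_basis :: "nat \<Rightarrow> ('p::finite \<Rightarrow> point \<Rightarrow> real) \<Rightarrow> bool" where
  "poly_basis N \<phi> \<longleftrightarrow>
     (\<forall>j. \<phi> j \<in> poly_space N) \<and>
     (\<forall>c. expand \<phi> c = (\<lambda>x. 0) \<longrightarrow> c = 0) \<and>
     (\<forall>p\<in>poly_space N. \<exists>c. p = expand \<phi> c)"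

section \<open>Faces and SBP quadrature rules\<close>

datatype face = Bottom | Hypotenuse | Left

fun face_param :: "face \<Rightarrow> real \<Rightarrow> point" where
  "face_param Bottom r = (r, -1)"
| "face_param Hypotenuse r = (-r, r)"
| "face_param Left r = (-1, -r)"

fun unit_normal :: "face \<Rightarrow> point" where
  "unit_normal Bottom = (0, -1)"
| "unit_normal Hypotenuse = (1 / sqrt 2, 1 / sqrt 2)"
| "unit_normal Left = (-1, 0)"

text \<open>Length of the face divided by the length of the parameter interval [-1,1].\<close>

definition face_jacobian :: "face \<Rightarrow> real" where
  "face_jacobian F = dist (face_param F (-1)) (face_param F 1) / 2"

definition scaled_normal :: "face \<Rightarrow> point" where
  "scaled_normal F = face_jacobian F *\<^sub>R unit_normal F"

text \<open>
  Exactness up to degree 2N-1 is phrased as d < 2N, so that it is vacuous for N = 0.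
  The volume nodes are pairwise distinct.

  Every surface node carries the face fc j it belongs to. A vertex can therefore occur once for each
  of its two faces, each time with its own weight and normal. The nodes of every face are the image
  of one set R of reference nodes in [-1,1]; the sign s leaves the orientation of each face free.
  Surface weights refer to the parameter interval [-1,1], because the face Jacobian is part of the
  scaled normal.
\<close>

definition sbp_quadrature ::
  "nat \<Rightarrow> ('q::finite \<Rightarrow> point) \<Rightarrow> ('q \<Rightarrow> real) \<Rightarrow>
   ('f::finite \<Rightarrow> face) \<Rightarrow> ('f \<Rightarrow> point) \<Rightarrow> ('f \<Rightarrow> real) \<Rightarrow> bool" where
  "sbp_quadrature N xq w fc xf ws \<longleftrightarrow>
     inj xq \<and> range xq \<subseteq> ref_triangle \<and> (\<forall>k. w k > 0) \<and>
     (\<forall>d < 2 * N. \<forall>p\<in>poly_space d. (\<Sum>k\<in>UNIV. w k * p (xq k)) = integral ref_triangle p) \<and>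
     range xf \<subseteq> range xq \<and>
     (\<exists>R \<subseteq> {-1..1}. \<forall>F. \<exists>s\<in>{1, -1}.
        bij_betw xf {j. fc j = F} ((\<lambda>r. face_param F (s * r)) ` R)) \<and>
     (\<forall>F. \<forall>p\<in>poly_space (2 * N).
        (\<Sum>j | fc j = F. ws j * p (xf j)) = integral {-1..1} (\<lambda>r. p (face_param F r)))"

section \<open>Matrices\<close>

definition diag_mat :: "('a \<Rightarrow> real) \<Rightarrow> real^'a^'a" where
  "diag_mat d = (\<chi> k l. if k = l then d k else 0)"

definition block_mat ::
  "real^'a^'a \<Rightarrow> real^'b^'a \<Rightarrow> real^'a^'b \<Rightarrow> real^'b^'b \<Rightarrow> real^('a + 'b)^('a + 'b)" where
  "block_mat A B C D = (\<chi> r c. case r of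
       Inl k \<Rightarrow> (case c of Inl l \<Rightarrow> A $ k $ l | Inr l \<Rightarrow> B $ k $ l)
     | Inr k \<Rightarrow> (case c of Inl l \<Rightarrow> C $ k $ l | Inr l \<Rightarrow> D $ k $ l))"

definition stack_mat :: "real^'c^'a \<Rightarrow> real^'c^'b \<Rightarrow> real^'c^('a + 'b)" where
  "stack_mat A B = (\<chi> r. case r of Inl k \<Rightarrow> A $ k | Inr k \<Rightarrow> B $ k)"

text \<open>The matrices V\_q and V\_f, for the volume and surface nodes respectively.\<close>

definition vandermonde :: "('p \<Rightarrow> point \<Rightarrow> real) \<Rightarrow> ('q \<Rightarrow> point) \<Rightarrow> real^'p^'q" where
  "vandermonde \<phi> xs = (\<chi> k j. \<phi> j (xs k))"

definition diff_mat :: "('p::finite \<Rightarrow> point \<Rightarrow> real) \<Rightarrow> point \<Rightarrow> real^'p^'p" where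
  "diff_mat \<phi> i = (THE D. \<forall>c. partial_deriv i (expand \<phi> c) = expand \<phi> (D *v c))"

definition mass_mat ::
  "('p::finite \<Rightarrow> point \<Rightarrow> real) \<Rightarrow> ('q::finite \<Rightarrow> point) \<Rightarrow> ('q \<Rightarrow> real) \<Rightarrow> real^'p^'p" where
  "mass_mat \<phi> xq w = transpose (vandermonde \<phi> xq) ** diag_mat w ** vandermonde \<phi> xq"

definition proj_mat ::
  "('p::finite \<Rightarrow> point \<Rightarrow> real) \<Rightarrow> ('q::finite \<Rightarrow> point) \<Rightarrow> ('q \<Rightarrow> real) \<Rightarrow> real^'q^'p" where
  "proj_mat \<phi> xq w =
     matrix_inv (mass_mat \<phi> xq w) ** transpose (vandermonde \<phi> xq) ** diag_mat w"

definition extrap_mat ::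
  "('p::finite \<Rightarrow> point \<Rightarrow> real) \<Rightarrow> ('q::finite \<Rightarrow> point) \<Rightarrow> ('q \<Rightarrow> real) \<Rightarrow>
   ('f::finite \<Rightarrow> point) \<Rightarrow> real^'q^'f" where
  "extrap_mat \<phi> xq w xf = vandermonde \<phi> xf ** proj_mat \<phi> xq w"

definition Q_mat ::
  "('p::finite \<Rightarrow> point \<Rightarrow> real) \<Rightarrow> ('q::finite \<Rightarrow> point) \<Rightarrow> ('q \<Rightarrow> real) \<Rightarrow>
   point \<Rightarrow> real^'q^'q" where
  "Q_mat \<phi> xq w i =
     transpose (proj_mat \<phi> xq w) ** mass_mat \<phi> xq w ** diff_mat \<phi> i ** proj_mat \<phi> xq w"

definition B_mat :: "('f::finite \<Rightarrow> face) \<Rightarrow> ('f \<Rightarrow> real) \<Rightarrow> point \<Rightarrow> real^'f^'f" where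
  "B_mat fc ws i = diag_mat ws ** diag_mat (\<lambda>j. scaled_normal (fc j) \<bullet> i)"

definition Q_hyb ::
  "('p::finite \<Rightarrow> point \<Rightarrow> real) \<Rightarrow> ('q::finite \<Rightarrow> point) \<Rightarrow> ('q \<Rightarrow> real) \<Rightarrow>
   ('f::finite \<Rightarrow> face) \<Rightarrow> ('f \<Rightarrow> point) \<Rightarrow> ('f \<Rightarrow> real) \<Rightarrow> point \<Rightarrow>
   real^('q + 'f)^('q + 'f)" where
  "Q_hyb \<phi> xq w fc xf ws i =
     (let Q = Q_mat \<phi> xq w i; E = extrap_mat \<phi> xq w xf; B = B_mat fc ws i
      in (1 / 2) *\<^sub>R block_mat (Q - transpose Q) (transpose E ** B) (- (B ** E)) B)"

definition sel_mat :: "('q \<Rightarrow> point) \<Rightarrow> ('f \<Rightarrow> point) \<Rightarrow> real^'q^'f" where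
  "sel_mat xq xf = (\<chi> j k. if xq k = xf j then 1 else 0)"

definition Q_SBP ::
  "('p::finite \<Rightarrow> point \<Rightarrow> real) \<Rightarrow> ('q::finite \<Rightarrow> point) \<Rightarrow> ('q \<Rightarrow> real) \<Rightarrow>
   ('f::finite \<Rightarrow> face) \<Rightarrow> ('f \<Rightarrow> point) \<Rightarrow> ('f \<Rightarrow> real) \<Rightarrow> point \<Rightarrow> real^'q^'q" where
  "Q_SBP \<phi> xq w fc xf ws i =
     transpose (stack_mat (mat 1) (sel_mat xq xf)) ** Q_hyb \<phi> xq w fc xf ws i
       ** stack_mat (mat 1) (sel_mat xq xf)"

definition D_SBP ::
  "('p::finite \<Rightarrow> point \<Rightarrow> real) \<Rightarrow> ('q::finite \<Rightarrow> point) \<Rightarrow> ('q \<Rightarrow> real) \<Rightarrow>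
   ('f::finite \<Rightarrow> face) \<Rightarrow> ('f \<Rightarrow> point) \<Rightarrow> ('f \<Rightarrow> real) \<Rightarrow> point \<Rightarrow> real^'q^'q" where
  "D_SBP \<phi> xq w fc xf ws i = matrix_inv (diag_mat w) ** Q_SBP \<phi> xq w fc xf ws i"

end

theory Submission
  imports Defs
begin

text \<open>
  For p, q of degree at most N both the volume rule on the derivative of pq and the surface rule on
  pq are exact, so the divergence theorem turns into the discrete identity
  M D + D' M = V\_f' B V\_f, a prime denoting the transpose. On the nodal values of a polynomial with
  coefficients c, the selection matrix agrees with the extrapolation E, so two of the three boundary
  terms of Q\_SBP cancel. By the discrete identity the remaining one cancels the transposed volume
  term and doubles the other one, which leaves W V\_q D c. The symmetric part only uses that B is
  diagonal.
\<close>

section \<open>Polynomial spaces\<close>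

lemma finite_degree_le [simp]: "finite {u. fst u + snd u \<le> (N :: nat)}"
  by (rule finite_subset[of _ "{..N} \<times> {..N}"]) auto

text \<open>One sum over exponent pairs, with monomials as functions of the point, is the shape to
  which the closure rules for sums, multiples and monomials apply directly.\<close>

lemma poly_spaceE:
  assumes "p \<in> poly_space N"
  obtains c where "p = (\<lambda>z. \<Sum>u | fst u + snd u \<le> N. c u * (fst z ^ fst u * snd z ^ snd u))"
proof -
  obtain c where "\<And>x y. p (x, y) = (\<Sum>(a, b) | a + b \<le> N. c a b * x ^ a * y ^ b)"
    using assms unfolding poly_space_def by blast
  then have "p = (\<lambda>z. \<Sum>u | fst u + snd u \<le> N.
      case_prod c u * (fst z ^ fst u * snd z ^ snd u))"
    by (auto simp: fun_eq_iff case_prod_beta mult.assoc intro!: sum.cong)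
  then show thesis by (rule that)
qed

lemma poly_space_monomial:
  assumes "a + b \<le> N"
  shows "(\<lambda>z. fst z ^ a * snd z ^ b) \<in> poly_space N"
proof -
  have "x ^ a * y ^ b = (\<Sum>(a', b') | a' + b' \<le> N.
      (if (a', b') = (a, b) then 1 else 0) * x ^ a' * y ^ b')" for x y :: real
  proof -
    have "(\<Sum>(a', b') | a' + b' \<le> N. (if (a', b') = (a, b) then 1 else 0) * x ^ a' * y ^ b')
        = (\<Sum>u | fst u + snd u \<le> N. if u = (a, b) then x ^ a * y ^ b else 0)"
      by (rule sum.cong) (auto split: if_splits)
    also have "\<dots> = x ^ a * y ^ b"
      using assms by (subst sum.delta) auto
    finally show ?thesis ..
  qed
  then show ?thesis
    unfolding poly_space_def
    by (auto intro!: exI[of _ "\<lambda>a' b'. if (a', b') = (a, b) then 1 else 0"])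
qed

lemma poly_space_zero: "(\<lambda>z. 0) \<in> poly_space N"
  unfolding poly_space_def by (auto intro!: exI[of _ "\<lambda>a b. 0"] simp: case_prod_beta)

lemma poly_space_add:
  assumes "p \<in> poly_space N" "q \<in> poly_space N"
  shows "(\<lambda>z. p z + q z) \<in> poly_space N"
proof -
  obtain c d where "\<And>x y. p (x, y) = (\<Sum>(a, b) | a + b \<le> N. c a b * x ^ a * y ^ b)"
    "\<And>x y. q (x, y) = (\<Sum>(a, b) | a + b \<le> N. d a b * x ^ a * y ^ b)"
    using assms unfolding poly_space_def by blast
  then have "p (x, y) + q (x, y) = (\<Sum>(a, b) | a + b \<le> N. (c a b + d a b) * x ^ a * y ^ b)" for x y
    by (simp add: sum.distrib[symmetric] case_prod_beta algebra_simps)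
  then show ?thesis
    unfolding poly_space_def by (auto intro!: exI[of _ "\<lambda>a b. c a b + d a b"])
qed

lemma poly_space_scale:
  assumes "p \<in> poly_space N"
  shows "(\<lambda>z. k * p z) \<in> poly_space N"
proof -
  obtain c where "\<And>x y. p (x, y) = (\<Sum>(a, b) | a + b \<le> N. c a b * x ^ a * y ^ b)"
    using assms unfolding poly_space_def by blast
  then have "k * p (x, y) = (\<Sum>(a, b) | a + b \<le> N. (k * c a b) * x ^ a * y ^ b)" for x y
    by (simp add: sum_distrib_left case_prod_beta algebra_simps)
  then show ?thesis
    unfolding poly_space_def by (auto intro!: exI[of _ "\<lambda>a b. k * c a b"])
qed

lemma poly_space_sum:
  assumes "\<And>u. u \<in> A \<Longrightarrow> f u \<in> poly_space N"
  shows "(\<lambda>z. \<Sum>u\<in>A. f u z) \<in> poly_space N"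
  using assms
  by (induction A rule: infinite_finite_induct) (auto intro: poly_space_zero poly_space_add)

lemma poly_space_mono:
  assumes "p \<in> poly_space M" "M \<le> N"
  shows "p \<in> poly_space N"
  using assms(1)
proof (rule poly_spaceE)
  fix c assume p: "p = (\<lambda>z. \<Sum>u | fst u + snd u \<le> M. c u * (fst z ^ fst u * snd z ^ snd u))"
  show ?thesis
    unfolding p using assms(2) by (intro poly_space_sum poly_space_scale poly_space_monomial) auto
qed

text \<open>Exponents of monomials add, so the product is a double sum of monomials of degree at
  most \<open>M + N\<close>. The closure rules accept the double sum, and like powers need not be
  collected.\<close>

lemma poly_space_mult:
  assumes "p \<in> poly_space M" "q \<in> poly_space N"
  shows "(\<lambda>z. p z * q z) \<in> poly_space (M + N)"
proof -
  obtain c where p: "p = (\<lambda>z. \<Sum>u | fst u + snd u \<le> M. c u * (fst z ^ fst u * snd z ^ snd u))"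
    using assms(1) by (rule poly_spaceE)
  obtain d where q: "q = (\<lambda>z. \<Sum>v | fst v + snd v \<le> N. d v * (fst z ^ fst v * snd z ^ snd v))"
    using assms(2) by (rule poly_spaceE)
  have "(\<lambda>z. p z * q z) = (\<lambda>z. \<Sum>u | fst u + snd u \<le> M. \<Sum>v | fst v + snd v \<le> N.
      (c u * d v) * (fst z ^ (fst u + fst v) * snd z ^ (snd u + snd v)))"
    unfolding p q by (simp add: sum_product power_add ac_simps)
  also have "\<dots> \<in> poly_space (M + N)"
    by (intro poly_space_sum poly_space_scale poly_space_monomial) auto
  finally show ?thesis .
qed

lemma continuous_on_poly_space:
  assumes "p \<in> poly_space N"
  shows "continuous_on S p"
  using assms by (rule poly_spaceE) (auto intro!: continuous_intros)

section \<open>Partial derivatives of polynomials\<close>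

lemma Basis_point: "(Basis :: point set) = {(1, 0), (0, 1)}"
  by (auto simp: Basis_prod_def)

lemma monomial_partial_deriv:
  assumes i: "i \<in> (Basis :: point set)" and ab: "a + b \<le> N"
  obtains p' where "p' \<in> poly_space (N - 1)"
    and "\<And>z t. ((\<lambda>t. fst (z + t *\<^sub>R i) ^ a * snd (z + t *\<^sub>R i) ^ b)
      has_real_derivative p' (z + t *\<^sub>R i)) (at t)"
proof -
  consider "i = (1, 0)" | "i = (0, 1)"
    using i by (auto simp: Basis_point)
  then show thesis
  proof cases
    case 1
    have "(\<lambda>z. real a * (fst z ^ (a - 1) * snd z ^ b)) \<in> poly_space (N - 1)"
    \<comment> \<open>Truncated subtraction gives \<open>a - 1 = 0\<close> here, and the remaining
      degree \<open>b\<close> may exceed \<open>N - 1\<close>; the factor \<open>real a\<close>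
      removes that term.\<close>
    proof (cases "a = 0")
      case True
      then show ?thesis by (simp add: poly_space_zero)
    next
      case False
      then show ?thesis using ab by (intro poly_space_scale poly_space_monomial) auto
    qed
    then show ?thesis
      by (rule that) (auto simp: 1 intro!: derivative_eq_intros)
  next
    case 2
    have "(\<lambda>z. real b * (fst z ^ a * snd z ^ (b - 1))) \<in> poly_space (N - 1)"
    proof (cases "b = 0")
      case True
      then show ?thesis by (simp add: poly_space_zero)
    next
      case False
      then show ?thesis using ab by (intro poly_space_scale poly_space_monomial) auto
    qed
    then show ?thesis
      by (rule that) (auto simp: 2 intro!: derivative_eq_intros)
  qed
qed

lemma partial_deriv_eqI:
  assumes "\<And>z. ((\<lambda>t. p (z + t *\<^sub>R i)) has_real_derivative p' z) (at 0)"
  shows "partial_deriv i p = p'"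
  using assms by (auto simp: partial_deriv_def fun_eq_iff intro: DERIV_imp_deriv)

text \<open>The derivative is stated at every \<open>t\<close> along the line through
  \<open>z\<close>, not only at 0, because the fundamental theorem of calculus is later applied on
  whole slices of the triangle.\<close>

lemma poly_space_partial_deriv:
  assumes p: "p \<in> poly_space N" and i: "i \<in> Basis"
  shows partial_deriv_in_poly_space: "partial_deriv i p \<in> poly_space (N - 1)"
    and has_partial_deriv:
      "((\<lambda>t. p (z + t *\<^sub>R i)) has_real_derivative partial_deriv i p (z + t *\<^sub>R i)) (at t)"
proof -
  obtain c where c: "p = (\<lambda>z. \<Sum>u | fst u + snd u \<le> N. c u * (fst z ^ fst u * snd z ^ snd u))"
    using p by (rule poly_spaceE)
  let ?deriv = "\<lambda>u p'. p' \<in> poly_space (N - 1) \<and>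
      (\<forall>z t. ((\<lambda>t. fst (z + t *\<^sub>R i) ^ fst u * snd (z + t *\<^sub>R i) ^ snd u)
        has_real_derivative p' (z + t *\<^sub>R i)) (at t))"
  have "\<exists>p'. ?deriv u p'" if u: "fst u + snd u \<le> N" for u
  proof (rule monomial_partial_deriv[OF i u])
    fix p'
    assume "p' \<in> poly_space (N - 1)"
      and "\<And>z t. ((\<lambda>t. fst (z + t *\<^sub>R i) ^ fst u * snd (z + t *\<^sub>R i) ^ snd u)
        has_real_derivative p' (z + t *\<^sub>R i)) (at t)"
    then show ?thesis by (intro exI[of _ p']) simp
  qed
  \<comment> \<open>Choosing one derivative per monomial allows the derivative of \<open>p\<close>
    to be assembled with the same coefficients.\<close>
  then have "\<exists>m'. \<forall>u\<in>{u. fst u + snd u \<le> N}. ?deriv u (m' u)"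
    by (intro bchoice) simp
  then obtain m' where "\<forall>u\<in>{u. fst u + snd u \<le> N}. ?deriv u (m' u)" ..
  then have m': "\<And>u. fst u + snd u \<le> N \<Longrightarrow> m' u \<in> poly_space (N - 1)"
    "\<And>u z t. fst u + snd u \<le> N \<Longrightarrow>
      ((\<lambda>t. fst (z + t *\<^sub>R i) ^ fst u * snd (z + t *\<^sub>R i) ^ snd u)
        has_real_derivative m' u (z + t *\<^sub>R i)) (at t)"
    by auto
  define p' where "p' = (\<lambda>z. \<Sum>u | fst u + snd u \<le> N. c u * m' u z)"
  have deriv: "((\<lambda>t. p (z + t *\<^sub>R i)) has_real_derivative p' (z + t *\<^sub>R i)) (at t)" for z t
    unfolding c p'_def by (intro DERIV_sum DERIV_cmult m'(2)) simp
  have eq: "partial_deriv i p = p'"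
    using deriv[where t = 0] by (intro partial_deriv_eqI) simp
  show "partial_deriv i p \<in> poly_space (N - 1)"
    unfolding eq p'_def by (intro poly_space_sum poly_space_scale m'(1)) simp
  show "((\<lambda>t. p (z + t *\<^sub>R i)) has_real_derivative partial_deriv i p (z + t *\<^sub>R i)) (at t)"
    unfolding eq by (rule deriv)
qed

lemma partial_deriv_mult:
  assumes "p \<in> poly_space M" "q \<in> poly_space N" "i \<in> Basis"
  shows "partial_deriv i (\<lambda>z. p z * q z) = (\<lambda>z. p z * partial_deriv i q z + partial_deriv i p z * q z)"
proof (rule partial_deriv_eqI)
  fix z
  show "((\<lambda>t. p (z + t *\<^sub>R i) * q (z + t *\<^sub>R i)) has_real_derivative
      p z * partial_deriv i q z + partial_deriv i p z * q z) (at 0)"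
    using DERIV_mult[OF has_partial_deriv[OF assms(1,3), of z 0]
        has_partial_deriv[OF assms(2,3), of z 0]]
    by (simp add: algebra_simps)
qed

lemma partial_deriv_expand:
  assumes "\<And>j. \<phi> j \<in> poly_space N" "i \<in> Basis"
  shows "partial_deriv i (expand \<phi> c) = expand (\<lambda>j. partial_deriv i (\<phi> j)) c"
proof (rule partial_deriv_eqI)
  fix z
  show "((\<lambda>t. expand \<phi> c (z + t *\<^sub>R i)) has_real_derivative
      expand (\<lambda>j. partial_deriv i (\<phi> j)) c z) (at 0)"
    unfolding expand_def
    using has_partial_deriv[OF assms, of _ z 0] by (intro DERIV_sum DERIV_cmult) simp
qed

section \<open>The divergence theorem on the reference triangle\<close>

lemma ref_triangle_eq: "ref_triangle = {(x, y). -1 \<le> x \<and> -1 \<le> y \<and> x + y \<le> 0}"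
proof (intro set_eqI iffI)
  fix z assume "z \<in> ref_triangle"
  then show "z \<in> {(x, y). -1 \<le> x \<and> -1 \<le> y \<and> x + y \<le> 0}"
    unfolding ref_triangle_def convex_hull_3 by (auto simp: algebra_simps)
next
  fix z :: point assume z: "z \<in> {(x, y). -1 \<le> x \<and> -1 \<le> y \<and> x + y \<le> 0}"
  then obtain x y where xy: "z = (x, y)" "-1 \<le> x" "-1 \<le> y" "x + y \<le> 0" by auto
  show "z \<in> ref_triangle"
    unfolding ref_triangle_def convex_hull_3 mem_Collect_eq
    using xy
    \<comment> \<open>The witnesses are the barycentric coordinates of (x, y) with respect to the
      vertices (-1, -1), (1, -1) and (-1, 1).\<close>
    by (intro exI[of _ "- (x + y) / 2"] exI[of _ "(x + 1) / 2"] exI[of _ "(y + 1) / 2"])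
       (auto simp: field_simps)
qed

lemma compact_ref_triangle: "compact ref_triangle"
  unfolding ref_triangle_def by (intro compact_convex_hull finite_imp_compact) auto

lemma integral_lborel_interval_FTC:
  fixes f g :: "real \<Rightarrow> real"
  assumes "a \<le> b" "\<And>t. (f has_real_derivative g t) (at t)" "continuous_on UNIV g"
  shows "(\<integral>t. indicator {a..b} t *\<^sub>R g t \<partial>lborel) = f b - f a"
  using assms
  by (intro integral_FTC_atLeastAtMost)
     (auto simp: has_real_derivative_iff_has_vector_derivative[symmetric]
           intro: has_field_derivative_at_within continuous_on_subset)

lemma integral_lborel_interval:
  fixes f :: "real \<Rightarrow> real"
  assumes "continuous_on {a..b} f"
  shows "(\<integral>t. indicator {a..b} t *\<^sub>R f t \<partial>lborel) = integral {a..b} f"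
  using set_borel_integral_eq_integral(2)[OF borel_integrable_atLeastAtMost'[OF assms]]
  by (simp add: set_lebesgue_integral_def)

text \<open>Fubini with \<open>y\<close> innermost: the vertical slice at \<open>x\<close> runs from
  the bottom face to the hypotenuse, and the fundamental theorem evaluates its integral by the
  values of \<open>f\<close> at these two ends.\<close>

lemma integral_ref_triangle_dy:
  fixes f g :: "point \<Rightarrow> real"
  assumes f: "continuous_on UNIV f" and g: "continuous_on UNIV g"
    and deriv: "\<And>x y. ((\<lambda>y. f (x, y)) has_real_derivative g (x, y)) (at y)"
  shows "integral ref_triangle g = integral {-1..1} (\<lambda>x. f (x, -x) - f (x, -1))"
proof -
  let ?G = "\<lambda>z. indicator ref_triangle z *\<^sub>R g z"
  have int: "integrable lborel ?G"
    using compact_ref_triangle continuous_on_subset[OF g] by (intro borel_integrable_compact) auto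
  have inner: "(\<integral>y. ?G (x, y) \<partial>lborel) = indicator {-1..1} x *\<^sub>R (f (x, -x) - f (x, -1))" for x
  proof (cases "x \<in> {-1..1}")
    case True
    \<comment> \<open>The slice is the interval from -1 to -x, which is nonempty exactly because
      \<open>x\<close> is at most 1.\<close>
    then have "(\<lambda>y. ?G (x, y)) = (\<lambda>y. indicator {-1..-x} y *\<^sub>R g (x, y))"
      by (auto simp: ref_triangle_eq indicator_def fun_eq_iff)
    moreover have "(\<integral>y. indicator {-1..-x} y *\<^sub>R g (x, y) \<partial>lborel) = f (x, -x) - f (x, -1)"
      using True
      by (intro integral_lborel_interval_FTC deriv continuous_on_compose2[OF g] continuous_intros) auto
    ultimately show ?thesis using True by simp
  next
    case False
    then have "(\<lambda>y. ?G (x, y)) = (\<lambda>y. 0)"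
      by (auto simp: ref_triangle_eq indicator_def fun_eq_iff)
    then show ?thesis using False by simp
  qed
  have "integral ref_triangle g = integral UNIV ?G"
    by (subst integral_restrict_UNIV[symmetric]) (auto simp: indicator_def intro!: integral_cong)
  also have "\<dots> = (\<integral>z. ?G z \<partial>lborel)"
    using int by (rule integral_lborel)
  also have "\<dots> = (\<integral>x. (\<integral>y. ?G (x, y) \<partial>lborel) \<partial>lborel)"
    using lborel_pair.integral_fst'[of ?G] int by (simp add: lborel_prod)
  also have "\<dots> = integral {-1..1} (\<lambda>x. f (x, -x) - f (x, -1))"
    unfolding inner
    by (intro integral_lborel_interval continuous_intros continuous_on_compose2[OF f]) auto
  finally show ?thesis .
qed

text \<open>The same argument with the order of integration exchanged; horizontal slices run from
  the left face to the hypotenuse.\<close>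

lemma integral_ref_triangle_dx:
  fixes f g :: "point \<Rightarrow> real"
  assumes f: "continuous_on UNIV f" and g: "continuous_on UNIV g"
    and deriv: "\<And>x y. ((\<lambda>x. f (x, y)) has_real_derivative g (x, y)) (at x)"
  shows "integral ref_triangle g = integral {-1..1} (\<lambda>y. f (-y, y) - f (-1, y))"
proof -
  let ?G = "\<lambda>z. indicator ref_triangle z *\<^sub>R g z"
  have int: "integrable lborel ?G"
    using compact_ref_triangle continuous_on_subset[OF g] by (intro borel_integrable_compact) auto
  have inner: "(\<integral>x. ?G (x, y) \<partial>lborel) = indicator {-1..1} y *\<^sub>R (f (-y, y) - f (-1, y))" for y
  proof (cases "y \<in> {-1..1}")
    case True
    then have "(\<lambda>x. ?G (x, y)) = (\<lambda>x. indicator {-1..-y} x *\<^sub>R g (x, y))"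
      by (auto simp: ref_triangle_eq indicator_def fun_eq_iff)
    moreover have "(\<integral>x. indicator {-1..-y} x *\<^sub>R g (x, y) \<partial>lborel) = f (-y, y) - f (-1, y)"
      using True
      by (intro integral_lborel_interval_FTC deriv continuous_on_compose2[OF g] continuous_intros) auto
    ultimately show ?thesis using True by simp
  next
    case False
    then have "(\<lambda>x. ?G (x, y)) = (\<lambda>x. 0)"
      by (auto simp: ref_triangle_eq indicator_def fun_eq_iff)
    then show ?thesis using False by simp
  qed
  have "integral ref_triangle g = integral UNIV ?G"
    by (subst integral_restrict_UNIV[symmetric]) (auto simp: indicator_def intro!: integral_cong)
  also have "\<dots> = (\<integral>z. ?G z \<partial>lborel)"
    using int by (rule integral_lborel)
  also have "\<dots> = (\<integral>y. (\<integral>x. ?G (x, y) \<partial>lborel) \<partial>lborel)"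
    using lborel_pair.integral_snd[of "\<lambda>x y. ?G (x, y)"] int
    unfolding case_prod_eta[of ?G] by (simp add: lborel_prod)
  also have "\<dots> = integral {-1..1} (\<lambda>y. f (-y, y) - f (-1, y))"
    unfolding inner
    by (intro integral_lborel_interval continuous_intros continuous_on_compose2[OF f]) auto
  finally show ?thesis .
qed

section \<open>Faces, scaled normals and boundary integrals\<close>

lemma UNIV_face: "UNIV = {Bottom, Hypotenuse, Left}"
  using face.exhaust by auto

instance face :: finite
  by standard (simp add: UNIV_face)

lemma sum_face: "(\<Sum>F\<in>UNIV. h F) = h Bottom + h Hypotenuse + h Left"
  for h :: "face \<Rightarrow> 'a::comm_monoid_add"
  by (simp add: UNIV_face add.assoc)

lemma scaled_normal_simps [simp]:
  "scaled_normal Bottom = (0, -1)"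
  "scaled_normal Hypotenuse = (1, 1)"
  "scaled_normal Left = (-1, 0)"
proof -
  \<comment> \<open>The hypotenuse has length \<open>sqrt 8\<close>, so its Jacobian is
    \<open>sqrt 2\<close> and cancels the normalisation of the unit normal.\<close>
  have "sqrt 8 = 2 * sqrt 2"
    using real_sqrt_mult[of 4 2] by simp
  then show "scaled_normal Hypotenuse = (1, 1)"
    by (simp add: scaled_normal_def face_jacobian_def dist_prod_def dist_real_def)
qed (simp_all add: scaled_normal_def face_jacobian_def dist_prod_def dist_real_def)

text \<open>The face parametrisations run counterclockwise, whereas the slice integrals run along
  increasing coordinates. Reflection reconciles the two.\<close>

lemma integral_reflect_unit: "integral {-1..1} (\<lambda>r. h (- r)) = integral {-1..1} h"
  for h :: "real \<Rightarrow> real"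
  using Henstock_Kurzweil_Integration.integral_reflect_real[of 1 "-1" h] by simp

text \<open>Integrating along slices in direction \<open>i\<close> leaves the difference of the
  values on two faces. Their scaled normals have components 1 and -1 in that direction, and the
  third face is parallel to it and contributes 0.\<close>

lemma divergence_theorem_ref_triangle:
  assumes p: "p \<in> poly_space N" and i: "i \<in> Basis"
  shows "integral ref_triangle (partial_deriv i p)
    = (\<Sum>F\<in>UNIV. (scaled_normal F \<bullet> i) * integral {-1..1} (\<lambda>r. p (face_param F r)))"
proof -
  note cont = continuous_on_poly_space[OF p]
    continuous_on_poly_space[OF partial_deriv_in_poly_space[OF p i]]
  have int: "(\<lambda>r. p (h r)) integrable_on {-1..1}" if "continuous_on {-1..1} h"
    for h :: "real \<Rightarrow> point"
    by (rule integrable_continuous_real, rule continuous_on_compose2[OF cont(1)[of UNIV] that]) simp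
  consider "i = (1, 0)" | "i = (0, 1)"
    using i by (auto simp: Basis_point)
  then show ?thesis
  proof cases
    case 1
    have "((\<lambda>x. p (x, y)) has_real_derivative partial_deriv i p (x, y)) (at x)" for x y
      \<comment> \<open>With the base point on the axis, the line parameter is the coordinate
        itself.\<close>
      using has_partial_deriv[OF p i, of "(0, y)" x] by (simp add: 1)
    then have "integral ref_triangle (partial_deriv i p)
        = integral {-1..1} (\<lambda>y. p (-y, y) - p (-1, y))"
      by (intro integral_ref_triangle_dx cont)
    also have "\<dots> = integral {-1..1} (\<lambda>y. p (-y, y)) - integral {-1..1} (\<lambda>y. p (-1, - y))"
      unfolding integral_reflect_unit[of "\<lambda>y. p (-1, y)"]
      by (intro integral_diff int) (auto intro!: continuous_intros)
    finally show ?thesis by (simp add: 1 sum_face)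
  next
    case 2
    have "((\<lambda>y. p (x, y)) has_real_derivative partial_deriv i p (x, y)) (at y)" for x y
      using has_partial_deriv[OF p i, of "(x, 0)" y] by (simp add: 2)
    then have "integral ref_triangle (partial_deriv i p)
        = integral {-1..1} (\<lambda>x. p (x, -x) - p (x, -1))"
      by (intro integral_ref_triangle_dy cont)
    also have "\<dots> = integral {-1..1} (\<lambda>x. p (-x, x)) - integral {-1..1} (\<lambda>x. p (x, -1))"
      using integral_reflect_unit[of "\<lambda>x. p (x, -x)"]
      by (subst integral_diff) (auto intro!: int continuous_intros)
    finally show ?thesis by (simp add: 2 sum_face)
  qed
qed

text \<open>Each sum is an exact evaluation of one side of the divergence theorem: the derivative
  has degree at most 2N - 1, within reach of the volume rule for positive \<open>N\<close>, and
  \<open>p\<close> has degree at most 2N, within reach of the surface rule.\<close>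

lemma sbp_quadrature_divergence:
  assumes quad: "sbp_quadrature N xq w fc xf ws"
    and p: "p \<in> poly_space (2 * N)" and i: "i \<in> Basis"
  shows "(\<Sum>k\<in>UNIV. w k * partial_deriv i p (xq k))
    = (\<Sum>j\<in>UNIV. ws j * (scaled_normal (fc j) \<bullet> i) * p (xf j))"
proof -
  have deriv: "partial_deriv i p \<in> poly_space (2 * N - 1)"
    using p i by (rule partial_deriv_in_poly_space)
  have vol: "(\<Sum>k\<in>UNIV. w k * partial_deriv i p (xq k)) = integral ref_triangle (partial_deriv i p)"
  proof (cases "N = 0")
    \<comment> \<open>Here the volume rule need not be exact for constants, but the derivative vanishes.\<close>
    case True
    have "((\<lambda>t. p (z + t *\<^sub>R i)) has_real_derivative 0) (at 0)" for z
    proof -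
      have "p (z + t *\<^sub>R i) = p z" for t
        using p unfolding True by (elim poly_spaceE) (simp cong: conj_cong)
      then show ?thesis by simp
    qed
    then have "partial_deriv i p = (\<lambda>z. 0)"
      by (rule partial_deriv_eqI)
    then show ?thesis by simp
  next
    case False
    then show ?thesis
      using quad deriv unfolding sbp_quadrature_def
      by (metis diff_less less_numeral_extra(1) mult_pos_pos neq0_conv zero_less_numeral)
  qed
  have "(\<Sum>j\<in>UNIV. ws j * (scaled_normal (fc j) \<bullet> i) * p (xf j))
      = (\<Sum>F\<in>UNIV. \<Sum>j | fc j = F. ws j * (scaled_normal (fc j) \<bullet> i) * p (xf j))"
    \<comment> \<open>Grouping by face makes the normal constant on each group, so the surface rule
      applies to \<open>p\<close> alone.\<close>
    using sum.group[of UNIV UNIV fc "\<lambda>j. ws j * (scaled_normal (fc j) \<bullet> i) * p (xf j)"] by simp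
  also have "\<dots> = (\<Sum>F\<in>UNIV. (scaled_normal F \<bullet> i) * (\<Sum>j | fc j = F. ws j * p (xf j)))"
    by (auto simp: sum_distrib_left intro!: sum.cong)
  also have "\<dots> = integral ref_triangle (partial_deriv i p)"
    using quad p unfolding divergence_theorem_ref_triangle[OF p i] sbp_quadrature_def by simp
  finally show ?thesis using vol by simp
qed

section \<open>Matrix identities\<close>

lemma sum_UNIV_Plus: "(\<Sum>u\<in>UNIV. h u) = (\<Sum>a\<in>UNIV. h (Inl a)) + (\<Sum>b\<in>UNIV. h (Inr b))"
  for h :: "'a::finite + 'b::finite \<Rightarrow> 'c::comm_monoid_add"
  by (subst UNIV_Plus_UNIV[symmetric], subst sum.Plus) simp_all

lemma stack_block_stack:
  fixes A :: "real^'c::finite^'a::finite" and B :: "real^'c^'b::finite"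
  shows "transpose (stack_mat A B) ** block_mat P Q R T ** stack_mat A B
    = transpose A ** P ** A + transpose A ** Q ** B + transpose B ** R ** A + transpose B ** T ** B"
  by (simp add: vec_eq_iff matrix_matrix_mult_def transpose_def stack_mat_def block_mat_def
      sum_UNIV_Plus distrib_right sum.distrib)

lemma transpose_diag_mat [simp]: "transpose (diag_mat d) = diag_mat d"
  by (auto simp: transpose_def diag_mat_def vec_eq_iff)

lemma transpose_add: "transpose (A + B) = transpose A + transpose B"
  by (simp add: transpose_def vec_eq_iff)

lemma transpose_diff: "transpose (A - B) = transpose A - transpose B"
  by (simp add: transpose_def vec_eq_iff)

lemma matrix_diff_rdistrib: "(A - B) ** C = A ** C - B ** C"
  for A :: "real^'b::finite^'a"
  by (simp add: matrix_matrix_mult_def vec_eq_iff left_diff_distrib sum_subtractf)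

lemma matrix_add_rdistrib: "(A + B) ** C = A ** C + B ** C"
  for A :: "real^'b::finite^'a"
  by (simp add: matrix_matrix_mult_def vec_eq_iff distrib_right sum.distrib)

lemma matrix_mult_minus_right: "A ** (- B) = - (A ** B)"
  for A :: "real^'b::finite^'a"
  by (simp add: matrix_matrix_mult_def vec_eq_iff sum_negf)

lemma matrix_inv_invertible:
  fixes A :: "real^'n::finite^'m::finite"
  assumes "invertible A"
  shows matrix_inv_right: "A ** matrix_inv A = mat 1"
    and matrix_inv_left: "matrix_inv A ** A = mat 1"
  using someI_ex[OF assms[unfolded invertible_def]] unfolding matrix_inv_def by auto

lemma diag_mat_mult_nth: "(diag_mat d ** A) $ k $ l = d k * A $ k $ l"
  for A :: "real^'b::finite^'a::finite"
  by (simp add: matrix_matrix_mult_def diag_mat_def if_distrib[of "\<lambda>x. x * _"] cong: if_cong)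

lemma diag_mat_mult_diag_mat: "diag_mat c ** diag_mat d = diag_mat (\<lambda>k. c k * d k)"
  for c d :: "'a::finite \<Rightarrow> real"
  by (simp add: vec_eq_iff diag_mat_mult_nth) (simp add: diag_mat_def)

lemma B_mat_eq: "B_mat fc ws i = diag_mat (\<lambda>j. ws j * (scaled_normal (fc j) \<bullet> i))"
  by (simp add: B_mat_def diag_mat_mult_diag_mat)

text \<open>This reads a matrix entry as a quadrature sum: with Vandermonde factors,
  \<open>d\<close> holds the weights and the columns hold nodal values of two functions.\<close>

lemma sandwich_diag_nth:
  fixes A :: "real^'a::finite^'c::finite" and B :: "real^'b::finite^'c"
  shows "(transpose A ** diag_mat d ** B) $ k $ l = (\<Sum>j\<in>UNIV. d j * (A $ j $ k * B $ j $ l))"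
proof -
  have "(transpose A ** (diag_mat d ** B)) $ k $ l
      = (\<Sum>j\<in>UNIV. transpose A $ k $ j * (diag_mat d ** B) $ j $ l)"
    by (simp only: matrix_matrix_mult_def[of "transpose A"] vec_lambda_beta)
  then show ?thesis
    by (simp only: matrix_mul_assoc diag_mat_mult_nth) (simp add: transpose_def ac_simps)
qed

lemma matrix_inv_diag_mat:
  fixes d :: "'a::finite \<Rightarrow> real"
  assumes "\<And>k. d k \<noteq> 0"
  shows "matrix_inv (diag_mat d) ** diag_mat d = mat 1"
proof -
  have "diag_mat (\<lambda>k. inverse (d k)) ** diag_mat d = mat 1"
    using assms by (simp add: diag_mat_mult_diag_mat) (simp add: diag_mat_def mat_def)
  then have "invertible (diag_mat d)"
    by (simp add: invertible_left_inverse) blast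
  then show ?thesis
    by (rule matrix_inv_left)
qed

text \<open>Distinct volume nodes leave at most one nonzero entry in each row of the selection
  matrix, so off-diagonal products vanish. A volume node may carry several surface nodes, as at a
  vertex, hence the sum on the diagonal.\<close>

lemma sel_mat_sandwich:
  fixes xq :: "'q::finite \<Rightarrow> point" and xf :: "'f::finite \<Rightarrow> point"
  assumes "inj xq"
  shows "transpose (sel_mat xq xf) ** diag_mat d ** sel_mat xq xf
    = diag_mat (\<lambda>k. \<Sum>j | xf j = xq k. d j)"
proof -
  have "(\<Sum>j\<in>UNIV. d j * ((if xq k = xf j then 1 else 0) * (if xq l = xf j then 1 else 0)))
      = (if k = l then \<Sum>j | xf j = xq k. d j else 0)" for k l
  proof (cases "k = l")
    case True
    then show ?thesis
      by (auto split: if_splits intro!: sum.mono_neutral_cong_right)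
  next
    case False
    then have "xq k \<noteq> xq l" using assms by (auto dest: injD)
    then show ?thesis using False by (auto intro!: sum.neutral)
  qed
  then show ?thesis
    by (simp add: vec_eq_iff sandwich_diag_nth) (simp add: sel_mat_def diag_mat_def)
qed

text \<open>Each row picks exactly one volume node: the inclusion of ranges gives existence and
  injectivity gives uniqueness.\<close>

lemma sel_mat_mult_vec:
  fixes xq :: "'q::finite \<Rightarrow> point" and xf :: "'f::finite \<Rightarrow> point"
  assumes "inj xq" "range xf \<subseteq> range xq"
  shows "sel_mat xq xf *v (\<chi> k. p (xq k)) = (\<chi> j. p (xf j))"
proof -
  have "(\<Sum>k\<in>UNIV. (if xq k = xf j then 1 else 0) * p (xq k)) = p (xf j)" for j
  proof -
    obtain k where k: "xf j = xq k" using assms(2) by blast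
    have "(\<Sum>k\<in>UNIV. (if xq k = xf j then 1 else 0) * p (xq k))
        = (\<Sum>l\<in>UNIV. if l = k then p (xq k) else 0)"
      using assms(1) by (intro sum.cong) (auto simp: k dest: injD)
    then show ?thesis by (simp add: k)
  qed
  then show ?thesis
    by (simp add: vec_eq_iff matrix_vector_mult_def sel_mat_def)
qed

lemma vandermonde_mult_vec: "vandermonde \<phi> xs *v c = (\<chi> k. expand \<phi> c (xs k))"
  for xs :: "'q::finite \<Rightarrow> point"
  by (simp add: vec_eq_iff matrix_vector_mult_def vandermonde_def expand_def mult.commute)

section \<open>The expanded form of \<open>Q_SBP\<close> and its symmetric part\<close>

lemma Q_SBP_eq:
  "Q_SBP \<phi> xq w fc xf ws i =
     (let Q = Q_mat \<phi> xq w i; E = extrap_mat \<phi> xq w xf; B = B_mat fc ws i; S = sel_mat xq xf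
      in (1 / 2) *\<^sub>R (Q - transpose Q + transpose E ** B ** S - transpose S ** B ** E
           + transpose S ** B ** S))"
  unfolding Q_SBP_def Q_hyb_def Let_def
  by (simp add: scalar_matrix_assoc[symmetric] matrix_scalar_ac stack_block_stack
      matrix_mult_minus_right matrix_mul_assoc)

text \<open>Both \<open>Q - transpose Q\<close> and \<open>X - transpose X\<close> are skew and drop
  out, while the symmetric \<open>Y\<close> appears twice with factor one half.\<close>

lemma Q_SBP_symmetric_part:
  "Q_SBP \<phi> xq w fc xf ws i + transpose (Q_SBP \<phi> xq w fc xf ws i)
    = transpose (sel_mat xq xf) ** B_mat fc ws i ** sel_mat xq xf"
proof -
  define X where "X = transpose (extrap_mat \<phi> xq w xf) ** B_mat fc ws i ** sel_mat xq xf"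
  define Y where "Y = transpose (sel_mat xq xf) ** B_mat fc ws i ** sel_mat xq xf"
  define Q where "Q = Q_mat \<phi> xq w i"
  have X: "transpose X = transpose (sel_mat xq xf) ** B_mat fc ws i ** extrap_mat \<phi> xq w xf"
    by (simp add: X_def B_mat_eq matrix_transpose_mul matrix_mul_assoc)
  have Y: "transpose Y = Y"
    by (simp add: Y_def B_mat_eq matrix_transpose_mul matrix_mul_assoc)
  have "Q_SBP \<phi> xq w fc xf ws i = (1 / 2) *\<^sub>R (Q - transpose Q + X - transpose X + Y)"
    unfolding X by (simp add: Q_SBP_eq Let_def X_def Y_def Q_def)
  then show ?thesis
    by (simp add: transpose_scalar transpose_add transpose_diff Y scaleR_half_double
        flip: scaleR_add_right Y_def)
qed

section \<open>Differentiation and integration by parts\<close>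

text \<open>A definite description has to be justified. Differentiation maps the polynomial space
  into itself, which gives a matrix, and linear independence of the basis makes it unique.\<close>

lemma diff_mat_works:
  assumes basis: "poly_basis N \<phi>" and i: "i \<in> Basis"
  shows "partial_deriv i (expand \<phi> c) = expand \<phi> (diff_mat \<phi> i *v c)"
proof -
  have \<phi>: "\<And>j. \<phi> j \<in> poly_space N"
    using basis by (simp add: poly_basis_def)
  have "\<exists>d. partial_deriv i (\<phi> j) = expand \<phi> d" for j
    using basis poly_space_mono[OF partial_deriv_in_poly_space[OF \<phi> i], of N]
    by (simp add: poly_basis_def)
  then obtain d where d: "\<And>j. partial_deriv i (\<phi> j) = expand \<phi> (d j)" by metis
  \<comment> \<open>Column \<open>j\<close> holds the coefficients of the derivative of the basis
    function \<open>\<phi> j\<close>.\<close>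
  let ?D = "\<chi> k j. d j $ k"
  have works: "partial_deriv i (expand \<phi> c) = expand \<phi> (?D *v c)" for c
    unfolding partial_deriv_expand[OF \<phi> i] d
    by (auto simp: expand_def fun_eq_iff matrix_vector_mult_def sum_distrib_left sum_distrib_right
        ac_simps intro: sum.swap)
  have "\<exists>!D. \<forall>c. partial_deriv i (expand \<phi> c) = expand \<phi> (D *v c)"
  proof (rule ex1I[of _ ?D])
    fix D assume D: "\<forall>c. partial_deriv i (expand \<phi> c) = expand \<phi> (D *v c)"
    have "D *v c = ?D *v c" for c
    proof -
      have "expand \<phi> (D *v c - ?D *v c) = (\<lambda>x. 0)"
        using D works[of c] by (simp add: expand_def fun_eq_iff left_diff_distrib sum_subtractf)
      then have "D *v c - ?D *v c = 0"
        using basis unfolding poly_basis_def by blast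
      then show ?thesis by simp
    qed
    then show "D = ?D" by (simp add: matrix_eq)
  qed (simp add: works)
  from theI'[OF this] show ?thesis
    unfolding diff_mat_def by blast
qed

lemma vandermonde_diff_mat:
  fixes xs :: "'q::finite \<Rightarrow> point"
  assumes basis: "poly_basis N \<phi>" and i: "i \<in> Basis"
  shows "vandermonde \<phi> xs ** diff_mat \<phi> i = vandermonde (\<lambda>j. partial_deriv i (\<phi> j)) xs"
proof -
  have "\<And>j. \<phi> j \<in> poly_space N"
    using basis by (simp add: poly_basis_def)
  then have "expand \<phi> (diff_mat \<phi> i *v c) = expand (\<lambda>j. partial_deriv i (\<phi> j)) c" for c
    using diff_mat_works[OF basis i] partial_deriv_expand i by metis
  then show ?thesis
    by (simp add: matrix_eq matrix_vector_mul_assoc[symmetric] vandermonde_mult_vec)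
qed

lemma transpose_mass_mat: "transpose (mass_mat \<phi> xq w) = mass_mat \<phi> xq w"
  by (simp add: mass_mat_def matrix_transpose_mul matrix_mul_assoc)

text \<open>Entry (k, l) of the left side is the volume rule applied to the derivative of the
  product of basis functions \<open>k\<close> and \<open>l\<close>. This product has degree at most
  2N, so \<open>sbp_quadrature_divergence\<close> applies.\<close>

lemma discrete_integration_by_parts:
  assumes basis: "poly_basis N \<phi>" and quad: "sbp_quadrature N xq w fc xf ws" and i: "i \<in> Basis"
  shows "mass_mat \<phi> xq w ** diff_mat \<phi> i + transpose (diff_mat \<phi> i) ** mass_mat \<phi> xq w
    = transpose (vandermonde \<phi> xf) ** B_mat fc ws i ** vandermonde \<phi> xf"
proof -
  let ?V = "vandermonde \<phi> xq" and ?V' = "vandermonde (\<lambda>j. partial_deriv i (\<phi> j)) xq"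
  have \<phi>: "\<And>j. \<phi> j \<in> poly_space N"
    using basis by (simp add: poly_basis_def)
  have MD: "mass_mat \<phi> xq w ** diff_mat \<phi> i = transpose ?V ** diag_mat w ** ?V'"
    by (simp add: mass_mat_def vandermonde_diff_mat[OF basis i] flip: matrix_mul_assoc)
  have "transpose (diff_mat \<phi> i) ** mass_mat \<phi> xq w
      = transpose (mass_mat \<phi> xq w ** diff_mat \<phi> i)"
    by (simp add: matrix_transpose_mul transpose_mass_mat)
  also have "\<dots> = transpose ?V' ** diag_mat w ** ?V"
    by (simp add: MD matrix_transpose_mul matrix_mul_assoc)
  finally have DM: "transpose (diff_mat \<phi> i) ** mass_mat \<phi> xq w
      = transpose ?V' ** diag_mat w ** ?V" .
  have "(\<Sum>q\<in>UNIV. w q * (\<phi> k (xq q) * partial_deriv i (\<phi> l) (xq q)))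
      + (\<Sum>q\<in>UNIV. w q * (partial_deriv i (\<phi> k) (xq q) * \<phi> l (xq q)))
      = (\<Sum>j\<in>UNIV. ws j * (scaled_normal (fc j) \<bullet> i) * (\<phi> k (xf j) * \<phi> l (xf j)))" for k l
    using sbp_quadrature_divergence[OF quad _ i, of "\<lambda>z. \<phi> k z * \<phi> l z"]
      poly_space_mult[OF \<phi>[of k] \<phi>[of l]]
    by (simp add: partial_deriv_mult[OF \<phi> \<phi> i] mult_2 distrib_left sum.distrib)
  then show ?thesis
    unfolding MD DM B_mat_eq vec_eq_iff vector_add_component sandwich_diag_nth
    by (simp add: vandermonde_def)
qed

lemma Q_SBP_expand:
  assumes basis: "poly_basis N \<phi>" and quad: "sbp_quadrature N xq w fc xf ws"
    and inv: "invertible (mass_mat \<phi> xq w)" and i: "i \<in> Basis"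
  shows "Q_SBP \<phi> xq w fc xf ws i *v (vandermonde \<phi> xq *v c)
    = diag_mat w *v (vandermonde \<phi> xq *v (diff_mat \<phi> i *v c))"
proof -
  define V where "V = vandermonde \<phi> xq"
  define Vf where "Vf = vandermonde \<phi> xf"
  define M where "M = mass_mat \<phi> xq w"
  define P where "P = proj_mat \<phi> xq w"
  define D where "D = diff_mat \<phi> i"
  define B where "B = B_mat fc ws i"
  define S where "S = sel_mat xq xf"
  have inj: "inj xq" "range xf \<subseteq> range xq"
    using quad unfolding sbp_quadrature_def by blast+
  have MM: "matrix_inv M ** M = mat 1" "M ** matrix_inv M = mat 1"
    using inv unfolding M_def by (simp_all add: matrix_inv_left matrix_inv_right)
  \<comment> \<open>Projecting the nodal values of a polynomial recovers its coefficients.\<close>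
  have PV: "P ** V = mat 1"
  proof -
    have "P ** V = matrix_inv M ** M"
      by (simp add: P_def proj_mat_def V_def M_def mass_mat_def matrix_mul_assoc)
    then show ?thesis by (simp only: MM)
  qed
  have MP: "M ** P = transpose V ** diag_mat w"
  proof -
    have "M ** P = M ** matrix_inv M ** (transpose V ** diag_mat w)"
      by (simp add: P_def proj_mat_def V_def M_def matrix_mul_assoc)
    then show ?thesis by (simp only: MM matrix_mul_lid)
  qed
  have PM: "transpose P ** M = diag_mat w ** V"
  proof -
    have "transpose P ** M = transpose (M ** P)"
      by (simp add: matrix_transpose_mul M_def transpose_mass_mat)
    then show ?thesis by (simp add: MP matrix_transpose_mul)
  qed
  \<comment> \<open>Surface nodes are volume nodes, so selecting nodal values is the same as
    evaluating at the surface nodes.\<close>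
  have SV: "S ** V = Vf"
    unfolding matrix_eq S_def V_def Vf_def
    by (simp add: matrix_vector_mul_assoc[symmetric] vandermonde_mult_vec sel_mat_mult_vec[OF inj])
  have parts: "transpose Vf ** B ** Vf = M ** D + transpose D ** M"
    using discrete_integration_by_parts[OF basis quad i] by (simp add: Vf_def B_def M_def D_def)
  have Q: "Q_mat \<phi> xq w i ** V = diag_mat w ** V ** D"
  proof -
    have "Q_mat \<phi> xq w i ** V = (transpose P ** M) ** D ** (P ** V)"
      by (simp add: Q_mat_def P_def M_def D_def matrix_mul_assoc)
    then show ?thesis by (simp only: PV PM matrix_mul_rid)
  qed
  have Qt: "transpose (Q_mat \<phi> xq w i) ** V = transpose P ** transpose D ** M"
  proof -
    have "transpose (Q_mat \<phi> xq w i) ** V = transpose P ** transpose D ** M ** (P ** V)"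
      by (simp add: Q_mat_def P_def M_def D_def matrix_transpose_mul transpose_mass_mat
          matrix_mul_assoc)
    then show ?thesis by (simp only: PV matrix_mul_rid)
  qed
  have E: "extrap_mat \<phi> xq w xf = Vf ** P"
    by (simp add: extrap_mat_def Vf_def P_def)
  \<comment> \<open>Once \<open>S ** V\<close> is \<open>Vf\<close>, the boundary matrix of the
    discrete integration by parts appears between \<open>transpose P\<close> and the
    coefficients.\<close>
  have EBS: "transpose (Vf ** P) ** B ** S ** V
      = diag_mat w ** V ** D + transpose P ** transpose D ** M"
  proof -
    have "transpose (Vf ** P) ** B ** S ** V = transpose P ** (transpose Vf ** B ** (S ** V))"
      by (simp only: matrix_transpose_mul matrix_mul_assoc)
    also have "\<dots> = transpose P ** M ** D + transpose P ** transpose D ** M"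
      by (simp only: SV parts matrix_add_ldistrib matrix_mul_assoc)
    finally show ?thesis by (simp only: PM)
  qed
  \<comment> \<open>Extrapolation and selection agree on polynomial data, since
    \<open>P ** V\<close> is the identity; this makes two boundary terms cancel.\<close>
  have SBE: "transpose S ** B ** (Vf ** P) ** V = transpose S ** B ** S ** V"
  proof -
    have "transpose S ** B ** (Vf ** P) ** V = transpose S ** B ** (Vf ** (P ** V))"
      by (simp only: matrix_mul_assoc)
    also have "\<dots> = transpose S ** B ** (S ** V)"
      by (simp only: PV SV matrix_mul_rid)
    finally show ?thesis by (simp only: matrix_mul_assoc)
  qed
  have "Q_SBP \<phi> xq w fc xf ws i ** V = diag_mat w ** V ** D"
    unfolding Q_SBP_eq Let_def E B_def[symmetric] S_def[symmetric]
    by (simp add: scalar_matrix_assoc[symmetric] matrix_add_rdistrib matrix_diff_rdistrib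
        Q Qt EBS SBE scaleR_half_double)
  then show ?thesis
    by (simp add: matrix_vector_mul_assoc matrix_mul_assoc flip: V_def D_def)
qed

theorem theorem3p1:
  fixes N :: nat
    and \<phi> :: "'p::finite \<Rightarrow> point \<Rightarrow> real"
    and xq :: "'q::finite \<Rightarrow> point" and w :: "'q \<Rightarrow> real"
    and fc :: "'f::finite \<Rightarrow> face" and xf :: "'f \<Rightarrow> point" and ws :: "'f \<Rightarrow> real"
  assumes "poly_basis N \<phi>"
    and "sbp_quadrature N xq w fc xf ws"
    and "invertible (mass_mat \<phi> xq w)"
  shows "\<forall>i \<in> (Basis :: point set).
      (\<forall>p \<in> poly_space N. \<forall>j.
         (D_SBP \<phi> xq w fc xf ws i *v (\<chi> k. p (xq k))) $ j = partial_deriv i p (xq j)) \<and>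
      Q_SBP \<phi> xq w fc xf ws i + transpose (Q_SBP \<phi> xq w fc xf ws i)
        = transpose (sel_mat xq xf) ** B_mat fc ws i ** sel_mat xq xf \<and>
      transpose (sel_mat xq xf) ** B_mat fc ws i ** sel_mat xq xf
        = diag_mat (\<lambda>k. \<Sum>j | xf j = xq k. ws j * (scaled_normal (fc j) \<bullet> i))"
proof (intro ballI conjI allI)
  fix i :: point assume i: "i \<in> Basis"
  show "Q_SBP \<phi> xq w fc xf ws i + transpose (Q_SBP \<phi> xq w fc xf ws i)
      = transpose (sel_mat xq xf) ** B_mat fc ws i ** sel_mat xq xf"
    by (rule Q_SBP_symmetric_part)
  have inj: "inj xq" and pos: "\<forall>k. w k > 0"
    using assms(2) unfolding sbp_quadrature_def by blast+
  have w: "w k \<noteq> 0" for k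
    using pos by (simp add: less_imp_neq[symmetric])
  from inj show "transpose (sel_mat xq xf) ** B_mat fc ws i ** sel_mat xq xf
      = diag_mat (\<lambda>k. \<Sum>j | xf j = xq k. ws j * (scaled_normal (fc j) \<bullet> i))"
    by (simp add: B_mat_eq sel_mat_sandwich)
  fix p j assume "p \<in> poly_space N"
  \<comment> \<open>In coefficients the nodal vector is \<open>vandermonde \<phi> xq *v c\<close>,
    the form that \<open>Q_SBP_expand\<close> handles.\<close>
  then obtain c where p: "p = expand \<phi> c"
    using assms(1) by (auto simp: poly_basis_def)
  have "D_SBP \<phi> xq w fc xf ws i *v (\<chi> k. p (xq k))
      = matrix_inv (diag_mat w) *v (Q_SBP \<phi> xq w fc xf ws i *v (vandermonde \<phi> xq *v c))"
    by (simp add: D_SBP_def p vandermonde_mult_vec matrix_vector_mul_assoc)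
  \<comment> \<open>The inverse of the diagonal weight matrix, which exists by positivity of the
    weights, removes the factor \<open>diag_mat w\<close>.\<close>
  also have "\<dots> = vandermonde \<phi> xq *v (diff_mat \<phi> i *v c)"
    unfolding Q_SBP_expand[OF assms i]
    by (subst matrix_vector_mul_assoc) (simp add: matrix_inv_diag_mat w)
  also have "\<dots> = (\<chi> k. partial_deriv i p (xq k))"
    by (simp add: p vandermonde_mult_vec diff_mat_works[OF assms(1) i])
  finally show "(D_SBP \<phi> xq w fc xf ws i *v (\<chi> k. p (xq k))) $ j = partial_deriv i p (xq j)"
    by simp
qed

end
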